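(* Let $E$ be a metric space with its Borel $\sigma$-algebra, let $d,\ell\in\mathbb{N}$, and let $\mathcal{F}=\{Y_{\mathbf n}:\mathbf n\in\mathbb{N}^d\}$ be a family of $E$-valued random variables. Let $\phi:\mathbb{N}^d\to D\subseteq\mathbb{R}^\ell$ be a homeomorphism onto its image $D=\operatorname{Im}\phi$. Let $\Delta\subseteq\overline{D}\setminus D$ be a nonempty Borel set, where $\overline D$ is the closure of $D$ in $\mathbb{R}^\ell$, and let $\{\mu_{\mathbf t}:\mathbf t\in\Delta\}$ be a weakly continuous family of probability measures on $E$. Assume that for any $\mathbf t\in\Delta$ and any sequence $(\mathbf N_n)_{n\in\mathbb{N}}$ in $\mathbb{N}^d$, $$Y_{\mathbf N_n}\Rightarrow\mu_{\mathbf t}\quad\text{whenever}\quad\phi(\mathbf N_n)\to\mathbf t .$$ Let $(\mathbf T_n)_{n\in\mathbb{N}}$ be a sequence of random variables with values in $\mathbb{N}^d$ such that $\mathbf T_n$ and $\mathcal{F}$ are independent for every $n\in\mathbb{N}$. Suppose that $\phi(\mathbf T_n)\Rightarrow\rho$ for some probability distribution $\rho$ with $\rho(\Delta)=1$. Then, as $n\to\infty$, $$Y_{\mathbf T_n}\Rightarrow\int_\Delta\mu_{\mathbf t}\,d\rho(\mathbf t).$$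
   Context: $\mathbb{N}=\{1,2,\ldots\}$. $\mathbb{N}^d$ and $D$ carry the topologies induced from $\mathbb{R}^d$ and $\mathbb{R}^\ell$; thus $\phi$ being a homeomorphism onto $D=\operatorname{Im}\phi$ means that $\phi$ is injective and $D$ is discrete, in the sense that every $\mathbf x\in D$ has an open neighborhood in $\mathbb{R}^\ell$ meeting $D$ only in $\mathbf x$. The symbol $\Rightarrow$ denotes convergence in distribution: $Z_n\Rightarrow\mu$ means that the distribution of $Z_n$ converges weakly to $\mu$, i.e. $\mathbb{E}[f(Z_n)]\to\int f\,d\mu$ for every bounded continuous real-valued $f$. A family $\{\mu_{\mathbf t}:\mathbf t\in\Delta\}$ is weakly continuous if $\mathbf t\mapsto\int_E f\,d\mu_{\mathbf t}$ is continuous on $\Delta$ for every bounded continuous $f:E\to\mathbb{R}$. The mixture $\int_\Delta\mu_{\mathbf t}\,d\rho(\mathbf t)$ is the probability measure on $E$ determined by $\int_E f\,d\bigl(\int_\Delta\mu_{\mathbf t}\,d\rho(\mathbf t)\bigr)=\int_\Delta\bigl(\int_E f\,d\mu_{\mathbf t}\bigr)d\rho(\mathbf t)$ for every bounded continuous $f:E\to\mathbb{R}$. $Y_{\mathbf T_n}$ is the random variable $\omega\mapsto Y_{\mathbf T_n(\omega)}(\omega)$. *)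

theory Defs
  imports "HOL-Probability.Probability"
begin

text \<open>Componentwise positive vectors of naturals. The product of the discrete topologies on
  \<^typ>\<open>nat\<close> agrees with the topology inherited from the Euclidean space; see
  \<open>homeomorphism_pos_vecs\<close> below.\<close>

definition pos_vecs :: "(nat ^ 'd) set" where
  "pos_vecs = {n. \<forall>i. 1 \<le> n $ i}"

definition bounded_continuous :: "('e::topological_space \<Rightarrow> real) \<Rightarrow> bool" where
  "bounded_continuous f \<longleftrightarrow> continuous_on UNIV f \<and> bounded (range f)"

definition borel_prob :: "'e::topological_space measure \<Rightarrow> bool" where
  "borel_prob \<mu> \<longleftrightarrow> prob_space \<mu> \<and> sets \<mu> = sets borel"

text \<open>The library's \<^const>\<open>weak_conv_m\<close> is phrased with distribution functions and is restricted
  to measures on the real line.\<close>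

definition converges_weakly ::
    "(nat \<Rightarrow> 'e::topological_space measure) \<Rightarrow> 'e measure \<Rightarrow> bool" where
  "converges_weakly \<mu>s \<mu> \<longleftrightarrow>
     (\<forall>n. borel_prob (\<mu>s n)) \<and> borel_prob \<mu> \<and>
     (\<forall>f. bounded_continuous f \<longrightarrow> (\<lambda>n. \<integral>x. f x \<partial>\<mu>s n) \<longlonglongrightarrow> (\<integral>x. f x \<partial>\<mu>))"

definition converges_in_distribution ::
    "'a measure \<Rightarrow> (nat \<Rightarrow> 'a \<Rightarrow> 'e::topological_space) \<Rightarrow> 'e measure \<Rightarrow> bool" where
  "converges_in_distribution M Z \<mu> \<longleftrightarrow>
     (\<forall>n. Z n \<in> borel_measurable M) \<and> converges_weakly (\<lambda>n. distr M borel (Z n)) \<mu>"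

definition weakly_continuous_family ::
    "'t::topological_space set \<Rightarrow> ('t \<Rightarrow> 'e::topological_space measure) \<Rightarrow> bool" where
  "weakly_continuous_family \<Delta> \<mu> \<longleftrightarrow>
     (\<forall>f. bounded_continuous f \<longrightarrow> continuous_on \<Delta> (\<lambda>t. \<integral>x. f x \<partial>\<mu> t))"

text \<open>The library's \<^const>\<open>prob_space.indep_var\<close>
  needs both variables to have the same codomain type, so independence of a variable and a family
  is expressed by \<^const>\<open>prob_space.indep_set\<close> of the \<open>\<sigma>\<close>-algebras they generate.\<close>

definition independent_of_family ::
    "'a measure \<Rightarrow> 'b measure \<Rightarrow> ('a \<Rightarrow> 'b) \<Rightarrow> 'i set \<Rightarrow> 'c measure \<Rightarrow> ('i \<Rightarrow> 'a \<Rightarrow> 'c) \<Rightarrow> bool"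
where
  "independent_of_family M N T I K Y \<longleftrightarrow>
     prob_space.indep_set M
       {T -` A \<inter> space M | A. A \<in> sets N}
       (sigma_sets (space M) (\<Union>i\<in>I. {Y i -` A \<inter> space M | A. A \<in> sets K}))"

definition is_mixture ::
    "'t::topological_space set \<Rightarrow> ('t \<Rightarrow> 'e::topological_space measure) \<Rightarrow> 't measure \<Rightarrow> 'e measure \<Rightarrow> bool"
where
  "is_mixture \<Delta> \<mu> \<rho> \<nu> \<longleftrightarrow> borel_prob \<nu> \<and>
     (\<forall>f. bounded_continuous f \<longrightarrow> (\<integral>x. f x \<partial>\<nu>) = (LINT t:\<Delta>|\<rho>. (\<integral>x. f x \<partial>\<mu> t)))"

text \<open>The description is justified by \<open>is_mixture_mixture\<close> and \<open>mixture_unique\<close> below.\<close>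

definition mixture ::
    "'t::topological_space set \<Rightarrow> ('t \<Rightarrow> 'e::topological_space measure) \<Rightarrow> 't measure \<Rightarrow> 'e measure"
where
  "mixture \<Delta> \<mu> \<rho> = (THE \<nu>. is_mixture \<Delta> \<mu> \<rho> \<nu>)"

lemma homeomorphism_pos_vecs:
  "homeomorphism (pos_vecs :: (nat ^ 'd) set)
     {x :: real ^ 'd. \<forall>i. \<exists>k::nat. 1 \<le> k \<and> x $ i = real k}
     (\<lambda>n. \<chi> i. real (n $ i)) (\<lambda>x. \<chi> i. nat \<lfloor>x $ i\<rfloor>)"
proof -
  let ?R = "{x :: real ^ 'd. \<forall>i. \<exists>k::nat. 1 \<le> k \<and> x $ i = real k}"
  have c1: "continuous_on pos_vecs (\<lambda>n::nat^'d. \<chi> i. real (n $ i))"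
  proof (rule continuous_on_vec_lambda)
    fix i
    have "continuous_on UNIV (real :: nat \<Rightarrow> real)" by simp
    then show "continuous_on pos_vecs (\<lambda>n::nat^'d. real (n $ i))"
      by (rule continuous_on_compose2) (auto intro!: continuous_on_component continuous_on_id)
  qed
  have fl: "continuous_on (range real) (\<lambda>x. nat \<lfloor>x\<rfloor>)"
  proof -
    have "\<exists>T. open T \<and> (\<lambda>x. nat \<lfloor>x\<rfloor>) -` B \<inter> range real = T \<inter> range real" for B :: "nat set"
    proof (intro exI conjI)
      show "open (\<Union>k\<in>B. ball (real k) 1)" by blast
      show "(\<lambda>x. nat \<lfloor>x\<rfloor>) -` B \<inter> range real = (\<Union>k\<in>B. ball (real k) 1) \<inter> range real"
        by (auto simp: dist_real_def) (metis abs_diff_less_iff add.commute less_add_one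
            of_nat_1 of_nat_add of_nat_less_iff less_Suc_eq_le Suc_eq_plus1 antisym less_diff_eq
            diff_less_eq)+
    qed
    then show ?thesis unfolding continuous_on_open_invariant by metis
  qed
  have c2: "continuous_on ?R (\<lambda>x. (\<chi> i. nat \<lfloor>x $ i\<rfloor>) :: nat ^ 'd)"
    by (intro continuous_on_vec_lambda continuous_on_compose2[OF fl] continuous_on_component
        continuous_on_id) auto
  show ?thesis
  proof (rule homeomorphismI[OF c1 c2])
    show "(\<lambda>n::nat^'d. \<chi> i. real (n $ i)) ` pos_vecs \<subseteq> ?R"
      by (auto simp: pos_vecs_def)
    show "(\<lambda>x. (\<chi> i. nat \<lfloor>x $ i\<rfloor>) :: nat ^ 'd) ` ?R \<subseteq> pos_vecs"
    proof (clarsimp simp: pos_vecs_def)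
      fix x :: "real ^ 'd" and i
      assume "\<forall>i. \<exists>k\<ge>Suc 0. x $ i = real k"
      then obtain k where "k \<ge> Suc 0" "x $ i = real k" by blast
      then show "Suc 0 \<le> nat \<lfloor>x $ i\<rfloor>" by simp
    qed
    show "(\<chi> i. nat \<lfloor>(\<chi> i. real ((n::nat^'d) $ i)) $ i\<rfloor>) = n" for n
      by (simp add: vec_eq_iff)
    show "(\<chi> i. real ((\<chi> i. nat \<lfloor>x $ i\<rfloor>) $ i)) = x" if "x \<in> ?R" for x
    proof (clarsimp simp: vec_eq_iff)
      fix i
      from that obtain k where "x $ i = real k" by blast
      then show "real (nat \<lfloor>x $ i\<rfloor>) = x $ i" by simp
    qed
  qed
qed

lemma closed_indicator_limit:
  fixes C :: "'e::metric_space set"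
  assumes "closed C" "C \<noteq> {}"
  defines "g \<equiv> \<lambda>k x. max 0 (1 - real k * infdist x C)"
  shows "bounded_continuous (g k)" and "0 \<le> g k x" and "g k x \<le> 1"
    and "(\<lambda>k. g k x) \<longlonglongrightarrow> indicator C x"
proof -
  show 1: "0 \<le> g k x" and 2: "g k x \<le> 1" for k x
    by (auto simp: g_def infdist_nonneg)
  have "continuous_on UNIV (g k)"
    unfolding g_def by (intro continuous_intros continuous_on_infdist)
  moreover have "bounded (range (g k))"
    using 1 2 by (intro boundedI[of _ 1]) auto
  ultimately show "bounded_continuous (g k)" by (simp add: bounded_continuous_def)
  show "(\<lambda>k. g k x) \<longlonglongrightarrow> indicator C x"
  proof (cases "x \<in> C")
    case True
    then show ?thesis by (simp add: g_def)
  next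
    case False
    with assms have pos: "infdist x C > 0"
      using in_closed_iff_infdist_zero infdist_nonneg[of x C] by force
    obtain K :: nat where K: "1 / infdist x C < K" using reals_Archimedean2 by blast
    have "g k x = 0" if "k \<ge> K" for k
    proof -
      have "1 / infdist x C < k" using K that by linarith
      then show ?thesis using pos by (simp add: g_def field_simps)
    qed
    then have "eventually (\<lambda>k. g k x = 0) sequentially"
      using eventually_sequentially by blast
    then show ?thesis using False by (simp add: tendsto_eventually)
  qed
qed

lemma measure_closed_limit:
  fixes C :: "'e::metric_space set"
  assumes "closed C" "C \<noteq> {}" "borel_prob \<nu>"
  shows "(\<lambda>k. \<integral>x. max 0 (1 - real k * infdist x C) \<partial>\<nu>) \<longlonglongrightarrow> measure \<nu> C"
proof -
  interpret prob_space \<nu> using assms by (simp add: borel_prob_def)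
  have sets[measurable_cong]: "sets \<nu> = sets borel" using assms by (simp add: borel_prob_def)
  have [measurable]: "C \<in> sets borel" using assms by simp
  have "(\<lambda>k. \<integral>x. max 0 (1 - real k * infdist x C) \<partial>\<nu>) \<longlonglongrightarrow> (\<integral>x. indicator C x \<partial>\<nu>)"
  proof (rule integral_dominated_convergence[where w = "\<lambda>_. 1"])
    have "continuous_on UNIV (\<lambda>x. max 0 (1 - real k * infdist x C))" for k
      by (intro continuous_intros continuous_on_infdist)
    then show "(\<lambda>x. max 0 (1 - real k * infdist x C)) \<in> borel_measurable \<nu>" for k
      unfolding measurable_cong_sets[OF sets refl] by (rule borel_measurable_continuous_onI)
    show "AE x in \<nu>. (\<lambda>k. max 0 (1 - real k * infdist x C)) \<longlonglongrightarrow> indicator C x"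
      using closed_indicator_limit(4)[OF assms(1,2)] by simp
    show "AE x in \<nu>. norm (max 0 (1 - real k * infdist x C)) \<le> 1" for k
      by (simp add: infdist_nonneg)
  qed auto
  then show ?thesis using assms(3) by (simp add: borel_prob_def)
qed

lemma borel_prob_eqI:
  fixes \<nu> \<nu>' :: "'e::metric_space measure"
  assumes "borel_prob \<nu>" "borel_prob \<nu>'"
    and eq: "\<And>f. bounded_continuous f \<Longrightarrow> (\<integral>x. f x \<partial>\<nu>) = (\<integral>x. f x \<partial>\<nu>')"
  shows "\<nu> = \<nu>'"
proof -
  interpret A: prob_space \<nu> using assms by (simp add: borel_prob_def)
  interpret B: prob_space \<nu>' using assms by (simp add: borel_prob_def)
  have sets: "sets \<nu> = sets borel" "sets \<nu>' = sets borel"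
    using assms by (auto simp: borel_prob_def)
  have b: "sets (borel :: 'e measure) = sigma_sets UNIV (Collect closed)"
    unfolding borel_eq_closed by simp
  show ?thesis
  proof (rule measure_eqI_generator_eq[where E = "Collect closed" and \<Omega> = UNIV and A = "\<lambda>_. UNIV"])
    fix C :: "'e set" assume "C \<in> Collect closed"
    then have C: "closed C" by simp
    show "emeasure \<nu> C = emeasure \<nu>' C"
    proof (cases "C = {}")
      case False
      have "measure \<nu> C = measure \<nu>' C"
        using measure_closed_limit[OF C False assms(1)] measure_closed_limit[OF C False assms(2)]
          eq[OF closed_indicator_limit(1)[OF C False]] by (auto intro: LIMSEQ_unique)
      then show ?thesis by (simp add: A.emeasure_eq_measure B.emeasure_eq_measure)
    qed simp
  qed (auto simp: sets b Int_stable_def)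
qed

lemma mixture_unique:
  fixes \<nu> :: "'e::metric_space measure"
  assumes "is_mixture \<Delta> \<mu> \<rho> \<nu>"
  shows "mixture \<Delta> \<mu> \<rho> = \<nu>"
  unfolding mixture_def using assms
  by (rule the_equality) (use assms in \<open>auto simp: is_mixture_def intro!: borel_prob_eqI\<close>)

lemma is_mixture_mixture:
  fixes \<mu> :: "'t::topological_space \<Rightarrow> 'e::metric_space measure"
  assumes \<rho>: "borel_prob \<rho>" and \<Delta>: "\<Delta> \<in> sets borel" "measure \<rho> \<Delta> = 1"
    and \<mu>: "\<And>t. t \<in> \<Delta> \<Longrightarrow> borel_prob (\<mu> t)" "weakly_continuous_family \<Delta> \<mu>"
  shows "is_mixture \<Delta> \<mu> \<rho> (mixture \<Delta> \<mu> \<rho>)"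
proof -
  interpret prob_space \<rho> using \<rho> by (simp add: borel_prob_def)
  have s\<rho>: "sets \<rho> = sets borel" using \<rho> by (simp add: borel_prob_def)
  then have sp: "space \<rho> = UNIV" using sets_eq_imp_space_eq by fastforce
  define R where "R = restrict_space \<rho> \<Delta>"
  have spR: "space R = \<Delta>" by (simp add: R_def space_restrict_space sp)
  have D: "\<Delta> \<inter> space \<rho> \<in> sets \<rho>" using \<Delta> s\<rho> sp by simp
  have R: "prob_space R"
    unfolding R_def using \<Delta> D emeasure_eq_measure[of \<Delta>]
    by (intro prob_space_restrict_space) (simp_all add: s\<rho>)
  have contR: "h \<in> borel_measurable R" if "continuous_on \<Delta> h" for h :: "'t \<Rightarrow> real"
  proof -
    have "h \<in> borel_measurable (restrict_space borel \<Delta>)"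
      using that by (rule borel_measurable_continuous_on_restrict)
    then show ?thesis
      unfolding R_def using sets_restrict_space_cong[OF s\<rho>] by (simp cong: measurable_cong_sets)
  qed
  have b: "sets (borel :: 'e measure) = sigma_sets UNIV (Collect closed)"
    unfolding borel_eq_closed by simp
  have K: "\<mu> \<in> measurable R (prob_algebra borel)"
  proof (rule measurable_prob_algebraI)
    show "prob_space (\<mu> t)" if "t \<in> space R" for t
      using \<mu>(1) that by (simp add: spR borel_prob_def)
    show "\<mu> \<in> measurable R (subprob_algebra borel)"
    proof (rule measurable_subprob_algebra_generated[OF b])
      show "Int_stable (Collect (closed :: 'e set \<Rightarrow> bool))" by (auto simp: Int_stable_def)
      show "subprob_space (\<mu> t)" "sets (\<mu> t) = sets borel" if "t \<in> space R" for t
        using \<mu>(1)[of t] that by (auto simp: spR borel_prob_def prob_space_imp_subprob_space)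
      have meas: "(\<lambda>t. emeasure (\<mu> t) C) \<in> borel_measurable R" if "closed C" for C
      proof (cases "C = {}")
        case False
        have "(\<lambda>t. measure (\<mu> t) C) \<in> borel_measurable R"
        proof (rule borel_measurable_LIMSEQ_real)
          show "(\<lambda>k. \<integral>x. max 0 (1 - real k * infdist x C) \<partial>\<mu> t) \<longlonglongrightarrow> measure (\<mu> t) C"
            if "t \<in> space R" for t
            using that \<mu>(1) measure_closed_limit[OF \<open>closed C\<close> False] by (simp add: spR)
          show "(\<lambda>t. \<integral>x. max 0 (1 - real k * infdist x C) \<partial>\<mu> t) \<in> borel_measurable R" for k
            using \<mu>(2) closed_indicator_limit(1)[OF \<open>closed C\<close> False, of k]
            by (intro contR) (simp add: weakly_continuous_family_def)
        qed
        then have "(\<lambda>t. ennreal (measure (\<mu> t) C)) \<in> borel_measurable R" by simp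
        moreover have "emeasure (\<mu> t) C = ennreal (measure (\<mu> t) C)" if "t \<in> space R" for t
        proof -
          interpret T: prob_space "\<mu> t" using \<mu>(1) that by (simp add: spR borel_prob_def)
          show ?thesis by (rule T.emeasure_eq_measure)
        qed
        ultimately show ?thesis by (simp cong: measurable_cong)
      qed simp
      show "(\<lambda>t. emeasure (\<mu> t) C) \<in> borel_measurable R" if "C \<in> Collect closed" for C
        using meas that by simp
      show "(\<lambda>t. emeasure (\<mu> t) UNIV) \<in> borel_measurable R" by (rule meas) simp
    qed simp
  qed
  then have K': "\<mu> \<in> measurable R (subprob_algebra borel)" by (rule measurable_prob_algebraD)
  have RA: "R \<in> space (prob_algebra R)" using R by (simp add: space_prob_algebra)
  have "is_mixture \<Delta> \<mu> \<rho> (R \<bind> \<mu>)"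
    unfolding is_mixture_def borel_prob_def
  proof (intro conjI allI impI)
    show "prob_space (R \<bind> \<mu>)" using prob_space_bind'[OF RA K] .
    show "sets (R \<bind> \<mu>) = sets borel" using sets_bind'[OF RA K] .
    fix f :: "'e \<Rightarrow> real" assume f: "bounded_continuous f"
    then obtain B where B: "\<And>x. \<bar>f x\<bar> \<le> B"
      by (auto simp: bounded_continuous_def bounded_iff)
    have fm: "f \<in> borel_measurable borel"
      using f by (intro borel_measurable_continuous_onI) (simp add: bounded_continuous_def)
    have "(\<integral>x. f x \<partial>(R \<bind> \<mu>)) = (\<integral>t. (\<integral>x. f x \<partial>\<mu> t) \<partial>R)"
    proof (rule integral_bind[OF fm _ K', where B = B and B' = 1])
      show "finite_measure R" using R by (simp add: prob_space.finite_measure)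
      show "AE t in R. emeasure (\<mu> t) (space (\<mu> t)) \<le> ennreal 1"
        using \<mu>(1) by (auto simp: spR borel_prob_def prob_space.emeasure_space_1)
    qed (use B in auto)
    also have "\<dots> = (LINT t:\<Delta>|\<rho>. (\<integral>x. f x \<partial>\<mu> t))"
      unfolding R_def set_lebesgue_integral_def by (rule integral_restrict_space[OF D])
    finally show "(\<integral>x. f x \<partial>(R \<bind> \<mu>)) = (LINT t:\<Delta>|\<rho>. (\<integral>x. f x \<partial>\<mu> t))" .
  qed
  then show ?thesis using mixture_unique by metis
qed

end

theory Submission
  imports Defs
begin

text \<open>Fix a bounded continuous \<open>f\<close> and put \<open>g n = E (f (Y n))\<close> and
  \<open>L t = \<integral>x. f x \<partial>\<mu> t\<close>. Two observations reduce the theorem to one about the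
  deterministic functions \<open>g\<close> and \<open>L\<close>.

  First, since \<open>T n\<close> is independent of the family and takes countably many values,
  \<open>E (f (Y (T n))) = E (g (T n))\<close> (\<open>expectation_at_independent_index\<close>). Second, the
  hypothesis on sequences says that \<open>g i\<close> tends to \<open>L t\<close> when \<open>\<phi> i\<close> tends
  to a point \<open>t\<close> of \<open>\<Delta>\<close>. What has to be shown is that weak convergence of
  \<open>\<phi> (T n)\<close> to \<open>\<rho>\<close> then gives \<open>E (g (T n)) \<longlonglongrightarrow> \<integral>t\<in>\<Delta>. L t \<partial>\<rho>\<close>,
  although \<open>g\<close> lives on the countable image of \<open>\<phi>\<close> and \<open>L\<close> on the disjoint
  set \<open>\<Delta>\<close>, so that neither is a test function for weak convergence.

  The bridge is a Lipschitz regularization in the manner of Baire: \<open>h\<^sub>k\<close>, the lower envelope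
  of the cones of slope \<open>k\<close> with apexes at the points \<open>(\<phi> i, g i)\<close>, capped at a
  bound for \<open>g\<close>, is defined, bounded and continuous everywhere. It satisfies \<open>h\<^sub>k (\<phi> i) \<le> g i\<close> and tends to \<open>L\<close>
  on \<open>\<Delta>\<close> as \<open>k\<close> grows (\<open>lower_regularization_tendsto\<close>). Hence \<open>E (g (T n))\<close>
  is at least \<open>E (h\<^sub>k (\<phi> (T n)))\<close>, which tends to \<open>\<integral>t. h\<^sub>k t \<partial>\<rho>\<close> by weak
  convergence, and the latter is close to \<open>\<integral>t\<in>\<Delta>. L t \<partial>\<rho>\<close> for large \<open>k\<close> by
  dominated convergence. This is the lower bound \<open>eventually_expectation_gt\<close>; applied to
  \<open>- g\<close> and \<open>- L\<close> it also gives the upper bound.\<close>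

section \<open>Expectations at an independent random index\<close>

lemma (in prob_space) abs_expectation_le:
  fixes X :: "'a \<Rightarrow> real"
  assumes "X \<in> borel_measurable M" and "\<And>\<omega>. \<bar>X \<omega>\<bar> \<le> B"
  shows "\<bar>\<integral>\<omega>. X \<omega> \<partial>M\<bar> \<le> B"
proof -
  have "\<bar>\<integral>\<omega>. X \<omega> \<partial>M\<bar> \<le> (\<integral>\<omega>. \<bar>X \<omega>\<bar> \<partial>M)"
    by (rule integral_abs_bound)
  also have "\<dots> \<le> (\<integral>\<omega>. B \<partial>M)"
    by (rule integral_mono) (use assms in \<open>auto intro!: integrable_const_bound[where B = B]\<close>)
  finally show ?thesis by (simp add: prob_space)
qed

text \<open>On the event \<open>T = i\<close> the integrand is \<open>f (Y i)\<close>, which is independent of that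
  event, so both sides have the integral \<open>P(T = i) * E (f (Y i))\<close> over it. Countability of
  \<open>I\<close> allows these contributions to be summed; it also makes the integrand on the left
  measurable.\<close>

lemma expectation_at_independent_index:
  fixes Y :: "'i \<Rightarrow> 'a \<Rightarrow> 'e::topological_space" and f :: "'e \<Rightarrow> real"
  assumes M: "prob_space M" and I: "countable I"
    and T[measurable]: "T \<in> measurable M (count_space I)"
    and Y: "\<And>i. i \<in> I \<Longrightarrow> Y i \<in> borel_measurable M"
    and indep: "independent_of_family M (count_space I) T I borel Y"
    and f: "f \<in> borel_measurable borel" and B: "\<And>x. \<bar>f x\<bar> \<le> B"
  shows "(\<integral>\<omega>. f (Y (T \<omega>) \<omega>) \<partial>M) = (\<integral>\<omega>. (\<integral>\<omega>'. f (Y (T \<omega>) \<omega>') \<partial>M) \<partial>M)"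
proof -
  interpret prob_space M by fact
  have TI: "T \<omega> \<in> I" if "\<omega> \<in> space M" for \<omega>
    using measurable_space[OF T that] by simp
  then have ne: "I \<noteq> {}" using not_empty by blast
  \<comment> \<open>The events \<open>T = i\<close>, indexed by numbers to fit countable additivity of the integral; the
    event is empty for a number that codes no element of \<open>I\<close>.\<close>
  define A where "A k = {\<omega> \<in> space M. to_nat_on I (T \<omega>) = k}" for k
  have A: "A k \<in> events" for k
    unfolding A_def by measurable
  have UA: "(\<Union>k. A k) = space M" by (auto simp: A_def)
  have disj: "A j \<inter> A k = {}" if "j \<noteq> k" for j k using that by (auto simp: A_def)
  have TA: "T \<omega> = from_nat_into I k" if "\<omega> \<in> A k" for k \<omega>
    using that TI I by (auto simp: A_def)
  define g where "g i = (\<integral>\<omega>. f (Y i \<omega>) \<partial>M)" for i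
  have fY: "(\<lambda>\<omega>. f (Y i \<omega>)) \<in> borel_measurable M" if "i \<in> I" for i
    using measurable_compose[OF Y[OF that] f] .
  have gB: "\<bar>g i\<bar> \<le> B" if "i \<in> I" for i
    unfolding g_def using fY[OF that] B by (rule abs_expectation_le)
  have int1: "integrable M (\<lambda>\<omega>. f (Y (T \<omega>) \<omega>))"
    by (rule integrable_const_bound[where B = B])
       (use B in \<open>auto intro!: measurable_compose_countable'[OF fY T I]\<close>)
  have int2: "integrable M (\<lambda>\<omega>. g (T \<omega>))"
    by (rule integrable_const_bound[where B = B])
       (use gB TI in \<open>auto intro!: measurable_compose[OF T]\<close>)
  have factor: "(\<integral>\<omega>. indicator (A k) \<omega> * f (Y i \<omega>) \<partial>M) = prob (A k) * g i" if i: "i \<in> I" for k i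
  proof -
    let ?X = "indicator (A k) :: 'a \<Rightarrow> real"
    have "indep_var borel ?X borel (\<lambda>\<omega>. f (Y i \<omega>))"
      unfolding indep_var_eq
    proof (intro conjI)
      show "random_variable borel ?X" using A by simp
      show "random_variable borel (\<lambda>\<omega>. f (Y i \<omega>))" using fY i by simp
      let ?G = "{T -` C \<inter> space M | C. C \<in> sets (count_space I)}"
      let ?H = "\<Union>i\<in>I. {Y i -` C \<inter> space M | C. C \<in> sets borel}"
      \<comment> \<open>The preimages under \<open>T\<close> form a \<open>\<sigma>\<close>-algebra already, so they contain everything
        generated by the indicator of \<open>A k\<close>.\<close>
      have G: "sets (vimage_algebra (space M) T (count_space I)) = ?G"
        by (rule sets_vimage_algebra2) (use TI in auto)
      have "?X -` C \<inter> space M \<in> ?G" for C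
        by (intro CollectI exI[of _ "{j \<in> I. indicator {k} (to_nat_on I j) \<in> C}"] conjI)
           (use TI in \<open>auto simp: A_def indicator_def split: if_splits\<close>)
      then have "{?X -` C \<inter> space M | C. C \<in> sets borel} \<subseteq> ?G" by blast
      then have "sigma_sets (space M) {?X -` C \<inter> space M | C. C \<in> sets borel} \<subseteq> ?G"
        using sets.sigma_sets_subset[of _ "vimage_algebra (space M) T (count_space I)"]
        unfolding G space_vimage_algebra by blast
      moreover have "sigma_sets (space M) {(\<lambda>\<omega>. f (Y i \<omega>)) -` C \<inter> space M | C. C \<in> sets borel}
          \<subseteq> sigma_sets (space M) ?H"
      proof (rule sigma_sets_subseteq, clarify)
        fix C :: "real set" assume "C \<in> sets borel"
        then have "f -` C \<in> sets borel" using measurable_sets[OF f] by simp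
        then show "(\<lambda>\<omega>. f (Y i \<omega>)) -` C \<inter> space M \<in> ?H"
          using i by (intro UN_I[OF i] CollectI exI[of _ "f -` C"]) auto
      qed
      moreover have "indep_set ?G (sigma_sets (space M) ?H)"
        using indep by (simp add: independent_of_family_def)
      ultimately show "indep_set (sigma_sets (space M) {?X -` C \<inter> space M | C. C \<in> sets borel})
          (sigma_sets (space M) {(\<lambda>\<omega>. f (Y i \<omega>)) -` C \<inter> space M | C. C \<in> sets borel})"
        unfolding indep_set_def by (elim indep_sets_mono_sets) (auto split: bool.split)
    qed
    then have "(\<integral>\<omega>. ?X \<omega> * f (Y i \<omega>) \<partial>M) = (\<integral>\<omega>. ?X \<omega> \<partial>M) * g i"
      unfolding g_def
      by (rule indep_var_lebesgue_integral)
         (use A B fY[OF i] in \<open>auto intro!: integrable_const_bound[where B = B] integrable_real_indicator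
            simp: emeasure_eq_measure\<close>)
    then show ?thesis using A by simp
  qed
  have "(LINT \<omega>:A k|M. f (Y (T \<omega>) \<omega>)) = (LINT \<omega>:A k|M. g (T \<omega>))" for k
  proof -
    let ?i = "from_nat_into I k"
    have i: "?i \<in> I" using ne by (rule from_nat_into)
    have "(LINT \<omega>:A k|M. f (Y (T \<omega>) \<omega>)) = (\<integral>\<omega>. indicator (A k) \<omega> * f (Y ?i \<omega>) \<partial>M)"
      unfolding set_lebesgue_integral_def
      by (intro Bochner_Integration.integral_cong) (auto simp: indicator_def TA)
    also have "\<dots> = (\<integral>\<omega>. indicator (A k) \<omega> * g ?i \<partial>M)"
      using factor[OF i] A by simp
    also have "\<dots> = (LINT \<omega>:A k|M. g (T \<omega>))"
      unfolding set_lebesgue_integral_def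
      by (intro Bochner_Integration.integral_cong) (auto simp: indicator_def TA)
    finally show ?thesis .
  qed
  moreover have "(\<integral>\<omega>. h \<omega> \<partial>M) = (\<Sum>k. LINT \<omega>:A k|M. h \<omega>)" if "integrable M h" for h :: "'a \<Rightarrow> real"
    using lebesgue_integral_countable_add[of A M h] A disj that UA
    by (simp add: set_integral_space set_integrable_def integrable_mult_indicator
        cong: Bochner_Integration.integrable_cong)
  ultimately have "(\<integral>\<omega>. f (Y (T \<omega>) \<omega>) \<partial>M) = (\<integral>\<omega>. g (T \<omega>) \<partial>M)"
    using int1 int2 by simp
  then show ?thesis by (simp add: g_def)
qed

section \<open>Lipschitz regularization from below\<close>

text \<open>The lower envelope of cones of slope \<open>k\<close> (the Pasch-Hausdorff envelope, or infimal
  convolution with \<open>k * dist\<close>), with the values \<open>g i\<close> prescribed at the points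
  \<open>\<phi> i\<close>. Working with the index \<open>i\<close> rather than the point spares an inverse of
  \<open>\<phi>\<close>. The cap at \<open>B\<close>, a bound for \<open>g\<close>, keeps the envelope bounded far away from
  the image of \<open>\<phi>\<close>.\<close>

definition lower_regularization ::
    "'i set \<Rightarrow> ('i \<Rightarrow> 'x::metric_space) \<Rightarrow> ('i \<Rightarrow> real) \<Rightarrow> real \<Rightarrow> nat \<Rightarrow> 'x \<Rightarrow> real" where
  "lower_regularization I \<phi> g B k x = (INF i\<in>I. min B (g i + real k * dist x (\<phi> i)))"

context
  fixes I :: "'i set" and \<phi> :: "'i \<Rightarrow> 'x::metric_space" and g :: "'i \<Rightarrow> real" and B :: real
  assumes ne: "I \<noteq> {}" and B: "\<And>i. i \<in> I \<Longrightarrow> \<bar>g i\<bar> \<le> B"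
begin

lemma lower_regularization_term_ge:
  "i \<in> I \<Longrightarrow> - B \<le> min B (g i + real k * dist x (\<phi> i))"
  using B[of i] by (smt (verit) mult_nonneg_nonneg of_nat_0_le_iff zero_le_dist)

lemma lower_regularization_le:
  assumes "i \<in> I"
  shows "lower_regularization I \<phi> g B k x \<le> min B (g i + real k * dist x (\<phi> i))"
  unfolding lower_regularization_def
  by (rule cINF_lower[OF bdd_belowI2[of _ "- B"] assms]) (rule lower_regularization_term_ge)

lemma lower_regularization_geI:
  "(\<And>i. i \<in> I \<Longrightarrow> m \<le> min B (g i + real k * dist x (\<phi> i))) \<Longrightarrow> m \<le> lower_regularization I \<phi> g B k x"
  unfolding lower_regularization_def by (rule cINF_greatest[OF ne])

lemma abs_lower_regularization_le: "\<bar>lower_regularization I \<phi> g B k x\<bar> \<le> B"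
proof -
  from ne obtain i where "i \<in> I" by blast
  from lower_regularization_le[OF this, of k x]
    lower_regularization_geI[of "- B" k x, OF lower_regularization_term_ge]
  show ?thesis by linarith
qed

text \<open>Each cone is Lipschitz with constant \<open>k\<close>, and so is an infimum of such functions.\<close>

lemma bounded_continuous_lower_regularization:
  "bounded_continuous (lower_regularization I \<phi> g B k)"
proof -
  let ?h = "lower_regularization I \<phi> g B k"
  have le: "?h x - real k * dist x y \<le> ?h y" for x y
  proof (rule lower_regularization_geI)
    fix i assume i: "i \<in> I"
    have "real k * dist x (\<phi> i) \<le> real k * dist x y + real k * dist y (\<phi> i)"
      by (metis distrib_left dist_triangle mult_left_mono of_nat_0_le_iff)
    then show "?h x - real k * dist x y \<le> min B (g i + real k * dist y (\<phi> i))"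
      using lower_regularization_le[OF i, of k x] mult_nonneg_nonneg[OF of_nat_0_le_iff zero_le_dist, of k x y]
      by linarith
  qed
  have "(real k)-lipschitz_on UNIV ?h"
  proof (rule lipschitz_onI)
    show "dist (?h x) (?h y) \<le> real k * dist x y" for x y
      using le[of x y] le[of y x] by (simp add: dist_real_def dist_commute abs_le_iff)
  qed simp
  then have "continuous_on UNIV ?h" by (rule lipschitz_on_continuous_on)
  moreover have "bounded (range ?h)"
    using abs_lower_regularization_le by (intro boundedI[of _ B]) auto
  ultimately show ?thesis by (simp add: bounded_continuous_def)
qed

text \<open>For large \<open>k\<close> only the indices with \<open>\<phi> i\<close> near \<open>t\<close> matter in the infimum,
  since the cones with distant apexes have already reached the cap at \<open>t\<close>; for the near ones
  \<open>g i\<close> is close to \<open>l\<close>. Conversely, as \<open>t\<close> is in the closure, for each fixed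
  \<open>k\<close> some apex is so near that its cone is still close to \<open>l\<close> at \<open>t\<close>.\<close>

lemma lower_regularization_tendsto:
  assumes t: "t \<in> closure (\<phi> ` I)"
    and lim: "\<And>e. 0 < e \<Longrightarrow> \<exists>d>0. \<forall>i\<in>I. dist (\<phi> i) t < d \<longrightarrow> \<bar>g i - l\<bar> < e"
  shows "(\<lambda>k. lower_regularization I \<phi> g B k t) \<longlonglongrightarrow> l"
proof (rule LIMSEQ_I)
  fix e :: real assume e: "0 < e"
  obtain d where d: "d > 0" "\<And>i. i \<in> I \<Longrightarrow> dist (\<phi> i) t < d \<Longrightarrow> \<bar>g i - l\<bar> < e / 2"
    using lim[of "e / 2"] e by (auto simp: Ball_def)
  have near: "\<exists>i\<in>I. dist (\<phi> i) t < r" if "r > 0" for r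
    using t that by (auto simp: closure_approachable)
  obtain j where j: "j \<in> I" "\<bar>g j - l\<bar> < e / 2" using near[OF d(1)] d(2) by blast
  \<comment> \<open>A cone of slope at least \<open>2 * B / d\<close> climbs from any value \<open>\<ge> - B\<close> to \<open>B\<close> within
    distance \<open>d\<close>.\<close>
  obtain K :: nat where K: "2 * B / d < real K" using reals_Archimedean2 by blast
  have "norm (lower_regularization I \<phi> g B k t - l) < e" if k: "k \<ge> max 1 K" for k
  proof -
    have kd: "2 * B \<le> real k * d"
    proof -
      have "2 * B / d \<le> real k" using K k by linarith
      then show ?thesis using d(1) by (simp add: pos_divide_le_eq)
    qed
    have lB: "l - e / 2 \<le> B" using j B[OF j(1)] by linarith
    have "l - e / 2 \<le> lower_regularization I \<phi> g B k t"
    proof (rule lower_regularization_geI)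
      fix i assume i: "i \<in> I"
      show "l - e / 2 \<le> min B (g i + real k * dist t (\<phi> i))"
      proof (cases "dist (\<phi> i) t < d")
        case True
        from d(2)[OF i this] lB mult_nonneg_nonneg[OF of_nat_0_le_iff zero_le_dist, of k t "\<phi> i"]
        show ?thesis by linarith
      next
        case False
        then have "real k * d \<le> real k * dist t (\<phi> i)"
          by (intro mult_left_mono) (auto simp: dist_commute)
        with kd lB B[OF i] show ?thesis by linarith
      qed
    qed
    moreover have "lower_regularization I \<phi> g B k t < l + e"
    proof -
      have "min d (e / (2 * real k)) > 0" using d e k by auto
      from near[OF this] obtain i where i: "i \<in> I" "dist (\<phi> i) t < d" "dist (\<phi> i) t < e / (2 * real k)"
        by auto
      have "real k * dist t (\<phi> i) < e / 2"
        using i(3) k by (simp add: dist_commute field_simps)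
      then show ?thesis
        using lower_regularization_le[OF i(1), of k t] d(2)[OF i(1,2)] by linarith
    qed
    ultimately show ?thesis using e by (simp add: abs_less_iff)
  qed
  then show "\<exists>n0. \<forall>n\<ge>n0. norm (lower_regularization I \<phi> g B n t - l) < e" by blast
qed

end

section \<open>Passing to the limit\<close>

text \<open>One half of a mapping theorem for a function that is given only on the image of \<open>\<phi>\<close>
  and on \<open>\<Delta>\<close>. Weak convergence is tested on the regularizations of \<open>g\<close>, which lie
  below \<open>g\<close> along \<open>\<phi>\<close> and converge to \<open>L\<close> almost surely for the limit law. Only
  the lower bound is stated, as the hypotheses are symmetric under a change of sign of \<open>g\<close> and
  \<open>L\<close>.\<close>

lemma eventually_expectation_gt:
  fixes \<phi> :: "'i \<Rightarrow> 'x::metric_space" and g :: "'i \<Rightarrow> real"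
  assumes M: "prob_space M"
    and T: "\<And>n \<omega>. \<omega> \<in> space M \<Longrightarrow> T n \<omega> \<in> I"
    and gT: "\<And>n. (\<lambda>\<omega>. g (T n \<omega>)) \<in> borel_measurable M"
    and B: "\<And>i. i \<in> I \<Longrightarrow> \<bar>g i\<bar> \<le> B"
    and conv: "converges_in_distribution M (\<lambda>n \<omega>. \<phi> (T n \<omega>)) \<rho>"
    and \<Delta>: "\<Delta> \<in> sets borel" "measure \<rho> \<Delta> = 1" "\<Delta> \<subseteq> closure (\<phi> ` I)"
    and L: "set_borel_measurable borel \<Delta> L"
    and lim: "\<And>t e. t \<in> \<Delta> \<Longrightarrow> 0 < e \<Longrightarrow> \<exists>d>0. \<forall>i\<in>I. dist (\<phi> i) t < d \<longrightarrow> \<bar>g i - L t\<bar> < e"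
    and a: "a < (LINT t:\<Delta>|\<rho>. L t)"
  shows "\<forall>\<^sub>F n in sequentially. a < (\<integral>\<omega>. g (T n \<omega>) \<partial>M)"
proof -
  interpret prob_space M by fact
  have ne: "I \<noteq> {}" using T not_empty by blast
  have Z: "(\<lambda>\<omega>. \<phi> (T n \<omega>)) \<in> borel_measurable M" for n
    using conv by (simp add: converges_in_distribution_def)
  have \<rho>: "borel_prob \<rho>"
    using conv by (simp add: converges_in_distribution_def converges_weakly_def)
  interpret R: prob_space \<rho> using \<rho> by (simp add: borel_prob_def)
  have s\<rho>: "sets \<rho> = sets borel" using \<rho> by (simp add: borel_prob_def)
  let ?h = "lower_regularization I \<phi> g B"
  have hm: "?h k \<in> borel_measurable borel" for k
    using bounded_continuous_lower_regularization[of I g B \<phi> k] ne B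
    by (intro borel_measurable_continuous_onI) (simp add: bounded_continuous_def)
  have "(\<lambda>k. \<integral>t. ?h k t \<partial>\<rho>) \<longlonglongrightarrow> (LINT t:\<Delta>|\<rho>. L t)"
    unfolding set_lebesgue_integral_def
  proof (rule integral_dominated_convergence[where w = "\<lambda>_. B"])
    show "(\<lambda>t. indicator \<Delta> t *\<^sub>R L t) \<in> borel_measurable \<rho>"
      using L unfolding set_borel_measurable_def measurable_cong_sets[OF s\<rho> refl] .
    show "?h k \<in> borel_measurable \<rho>" for k
      using hm unfolding measurable_cong_sets[OF s\<rho> refl] .
    have "AE t in \<rho>. t \<in> \<Delta>" using \<Delta> by (intro R.AE_prob_1)
    then show "AE t in \<rho>. (\<lambda>k. ?h k t) \<longlonglongrightarrow> indicator \<Delta> t *\<^sub>R L t"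
    proof (rule AE_mp, intro AE_I2 impI)
      fix t assume t: "t \<in> \<Delta>"
      have "(\<lambda>k. ?h k t) \<longlonglongrightarrow> L t"
        by (rule lower_regularization_tendsto[OF ne]) (use B \<Delta> t lim in auto)
      then show "(\<lambda>k. ?h k t) \<longlonglongrightarrow> indicator \<Delta> t *\<^sub>R L t" using t by simp
    qed
    show "AE t in \<rho>. norm (?h k t) \<le> B" for k
      using abs_lower_regularization_le[of I g B \<phi> k] ne B by simp
  qed simp
  from order_tendstoD(1)[OF this a] obtain k where k: "a < (\<integral>t. ?h k t \<partial>\<rho>)"
    by (auto simp: eventually_sequentially)
  have "(\<lambda>n. \<integral>x. ?h k x \<partial>distr M borel (\<lambda>\<omega>. \<phi> (T n \<omega>))) \<longlonglongrightarrow> (\<integral>t. ?h k t \<partial>\<rho>)"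
    using conv bounded_continuous_lower_regularization[of I g B \<phi> k] ne B
    by (simp add: converges_in_distribution_def converges_weakly_def)
  from order_tendstoD(1)[OF this k] show ?thesis
  proof (rule eventually_mono)
    fix n
    assume "a < (\<integral>x. ?h k x \<partial>distr M borel (\<lambda>\<omega>. \<phi> (T n \<omega>)))"
    also have "\<dots> = (\<integral>\<omega>. ?h k (\<phi> (T n \<omega>)) \<partial>M)" by (rule integral_distr[OF Z hm])
    also have "\<dots> \<le> (\<integral>\<omega>. g (T n \<omega>) \<partial>M)"
    proof (rule integral_mono)
      show "integrable M (\<lambda>\<omega>. ?h k (\<phi> (T n \<omega>)))"
        by (rule integrable_const_bound[where B = B])
           (use abs_lower_regularization_le[of I g B \<phi> k] ne B measurable_compose[OF Z hm] in auto)
      show "integrable M (\<lambda>\<omega>. g (T n \<omega>))"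
        by (rule integrable_const_bound[where B = B]) (use B T gT in auto)
      show "?h k (\<phi> (T n \<omega>)) \<le> g (T n \<omega>)" if "\<omega> \<in> space M" for \<omega>
        using lower_regularization_le[of I g B "T n \<omega>" \<phi> k "\<phi> (T n \<omega>)"] ne B T[OF that, of n] by simp
    qed
    finally show "a < (\<integral>\<omega>. g (T n \<omega>) \<partial>M)" .
  qed
qed

theorem theorem1:
  fixes M :: "'a measure"
    and Y :: "nat ^ 'd \<Rightarrow> 'a \<Rightarrow> 'e::metric_space"
    and \<phi> :: "nat ^ 'd \<Rightarrow> real ^ 'l"
    and D \<Delta> :: "(real ^ 'l) set"
    and \<mu> :: "real ^ 'l \<Rightarrow> 'e measure"
    and T :: "nat \<Rightarrow> 'a \<Rightarrow> nat ^ 'd"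
    and \<rho> :: "(real ^ 'l) measure"
  assumes "prob_space M"
    and "\<And>n. n \<in> pos_vecs \<Longrightarrow> Y n \<in> borel_measurable M"
    and "D = \<phi> ` pos_vecs"
    and "\<exists>\<psi>. homeomorphism pos_vecs D \<phi> \<psi>"
    and "\<Delta> \<noteq> {}" and "\<Delta> \<in> sets borel" and "\<Delta> \<subseteq> closure D - D"
    and "\<And>t. t \<in> \<Delta> \<Longrightarrow> borel_prob (\<mu> t)"
    and "weakly_continuous_family \<Delta> \<mu>"
    and "\<And>t N. \<lbrakk>t \<in> \<Delta>; \<And>n. N n \<in> pos_vecs; (\<lambda>n. \<phi> (N n)) \<longlonglongrightarrow> t\<rbrakk>
            \<Longrightarrow> converges_in_distribution M (\<lambda>n. Y (N n)) (\<mu> t)"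
    and "\<And>n. T n \<in> measurable M (count_space pos_vecs)"
    and "\<And>n. independent_of_family M (count_space pos_vecs) (T n) pos_vecs borel Y"
    and "borel_prob \<rho>" and "measure \<rho> \<Delta> = 1"
    and "converges_in_distribution M (\<lambda>n \<omega>. \<phi> (T n \<omega>)) \<rho>"
  shows "converges_in_distribution M (\<lambda>n \<omega>. Y (T n \<omega>) \<omega>) (mixture \<Delta> \<mu> \<rho>)"
proof -
  interpret prob_space M by fact
  let ?I = "pos_vecs :: (nat ^ 'd) set"
  have T: "T n \<omega> \<in> ?I" if "\<omega> \<in> space M" for n \<omega>
    using measurable_space[OF assms(11) that] by simp
  have YT: "(\<lambda>\<omega>. Y (T n \<omega>) \<omega>) \<in> borel_measurable M" for n
    by (rule measurable_compose_countable'[OF assms(2) assms(11)]) auto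
  have mix: "is_mixture \<Delta> \<mu> \<rho> (mixture \<Delta> \<mu> \<rho>)"
    using assms by (intro is_mixture_mixture) auto
  have main: "(\<lambda>n. \<integral>\<omega>. f (Y (T n \<omega>) \<omega>) \<partial>M) \<longlonglongrightarrow> (LINT t:\<Delta>|\<rho>. (\<integral>x. f x \<partial>\<mu> t))"
    if f: "bounded_continuous f" for f :: "'e \<Rightarrow> real"
  proof -
    have fm: "f \<in> borel_measurable borel"
      using f by (intro borel_measurable_continuous_onI) (simp add: bounded_continuous_def)
    obtain B where B: "\<And>x. \<bar>f x\<bar> \<le> B"
      using f by (auto simp: bounded_continuous_def bounded_iff)
    define g where "g i = (\<integral>\<omega>. f (Y i \<omega>) \<partial>M)" for i
    define L where "L t = (\<integral>x. f x \<partial>\<mu> t)" for t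
    have gB: "\<bar>g i\<bar> \<le> B" if "i \<in> ?I" for i
      unfolding g_def using measurable_compose[OF assms(2)[OF that] fm] B by (rule abs_expectation_le)
    have gT: "(\<lambda>\<omega>. g (T n \<omega>)) \<in> borel_measurable M" for n
      by (rule measurable_compose[OF assms(11)]) simp
    have L: "set_borel_measurable borel \<Delta> L"
      unfolding set_borel_measurable_def L_def
      using assms(6,9) f
      by (intro borel_measurable_continuous_on_indicator) (auto simp: weakly_continuous_family_def)
    \<comment> \<open>The hypothesis on sequences in \<open>\<epsilon>\<close>-\<open>\<delta>\<close> form: a failure at every radius
      \<open>1 / (n + 1)\<close> would give a sequence violating it.\<close>
    have lim: "\<exists>d>0. \<forall>i\<in>?I. dist (\<phi> i) t < d \<longrightarrow> \<bar>g i - L t\<bar> < e" if t: "t \<in> \<Delta>" and e: "e > 0" for t e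
    proof (rule ccontr)
      assume "\<not> ?thesis"
      then have "\<forall>d>0. \<exists>i\<in>?I. dist (\<phi> i) t < d \<and> e \<le> \<bar>g i - L t\<bar>" by (meson not_less)
      then have "\<forall>n. \<exists>i. i \<in> ?I \<and> dist (\<phi> i) t < inverse (real (Suc n)) \<and> e \<le> \<bar>g i - L t\<bar>"
        by (meson inverse_positive_iff_positive of_nat_0_less_iff zero_less_Suc)
      then obtain N where N: "\<And>n. N n \<in> ?I" "\<And>n. dist (\<phi> (N n)) t < inverse (real (Suc n))"
          "\<And>n. e \<le> \<bar>g (N n) - L t\<bar>"
        by metis
      have "(\<lambda>n. dist (\<phi> (N n)) t) \<longlonglongrightarrow> 0"
        by (rule tendsto_sandwich[OF _ _ tendsto_const LIMSEQ_inverse_real_of_nat])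
           (use N(2) in \<open>auto intro!: always_eventually less_imp_le\<close>)
      then have "(\<lambda>n. \<phi> (N n)) \<longlonglongrightarrow> t" by (rule tendsto_dist_iff[THEN iffD2])
      from assms(10)[OF t N(1) this]
      have "(\<lambda>n. \<integral>x. f x \<partial>distr M borel (Y (N n))) \<longlonglongrightarrow> L t"
        using f by (simp add: L_def converges_in_distribution_def converges_weakly_def)
      moreover have "(\<integral>x. f x \<partial>distr M borel (Y (N n))) = g (N n)" for n
        unfolding g_def using assms(2)[OF N(1)] fm by (rule integral_distr)
      ultimately have "(\<lambda>n. g (N n)) \<longlonglongrightarrow> L t" by simp
      from LIMSEQ_D[OF this e] N(3) show False by (auto simp: not_less[symmetric])
    qed
    have cl: "\<Delta> \<subseteq> closure (\<phi> ` ?I)" using assms(3,7) by blast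
    have "(\<lambda>n. \<integral>\<omega>. g (T n \<omega>) \<partial>M) \<longlonglongrightarrow> (LINT t:\<Delta>|\<rho>. L t)"
    proof (rule order_tendstoI)
      fix a assume "a < (LINT t:\<Delta>|\<rho>. L t)"
      then show "\<forall>\<^sub>F n in sequentially. a < (\<integral>\<omega>. g (T n \<omega>) \<partial>M)"
        by (intro eventually_expectation_gt[where g = g and T = T and I = ?I and B = B and L = L,
              OF assms(1) T gT gB assms(15,6,14) cl L lim])
    next
      fix a assume "(LINT t:\<Delta>|\<rho>. L t) < a"
      then have a: "- a < (LINT t:\<Delta>|\<rho>. - L t)"
        by (simp add: set_lebesgue_integral_def)
      have "\<forall>\<^sub>F n in sequentially. - a < (\<integral>\<omega>. - g (T n \<omega>) \<partial>M)"
      proof (rule eventually_expectation_gt[where g = "\<lambda>i. - g i" and T = T and I = ?I and B = B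
            and L = "\<lambda>t. - L t", OF assms(1) T _ _ assms(15,6,14) cl _ _ a])
        show "set_borel_measurable borel \<Delta> (\<lambda>t. - L t)"
          using L by (simp add: set_borel_measurable_def)
        show "\<exists>d>0. \<forall>i\<in>?I. dist (\<phi> i) t < d \<longrightarrow> \<bar>- g i - - L t\<bar> < e" if "t \<in> \<Delta>" "0 < e" for t e
          using lim[OF that] by (simp add: abs_minus_commute)
      qed (use gT gB in auto)
      then show "\<forall>\<^sub>F n in sequentially. (\<integral>\<omega>. g (T n \<omega>) \<partial>M) < a" by simp
    qed
    moreover have "(\<integral>\<omega>. f (Y (T n \<omega>) \<omega>) \<partial>M) = (\<integral>\<omega>. g (T n \<omega>) \<partial>M)" for n
      unfolding g_def
      by (rule expectation_at_independent_index[OF assms(1) _ assms(11) assms(2) assms(12) fm B]) auto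
    ultimately show ?thesis by (simp add: L_def)
  qed
  show ?thesis
    unfolding converges_in_distribution_def converges_weakly_def
  proof (intro conjI allI impI)
    show "(\<lambda>\<omega>. Y (T n \<omega>) \<omega>) \<in> borel_measurable M" for n by (rule YT)
    show "borel_prob (distr M borel (\<lambda>\<omega>. Y (T n \<omega>) \<omega>))" for n
      using YT by (simp add: borel_prob_def prob_space_distr)
    show "borel_prob (mixture \<Delta> \<mu> \<rho>)" using mix by (simp add: is_mixture_def)
    fix f :: "'e \<Rightarrow> real" assume f: "bounded_continuous f"
    then have fm: "f \<in> borel_measurable borel"
      by (intro borel_measurable_continuous_onI) (simp add: bounded_continuous_def)
    show "(\<lambda>n. \<integral>x. f x \<partial>distr M borel (\<lambda>\<omega>. Y (T n \<omega>) \<omega>)) \<longlonglongrightarrow> (\<integral>x. f x \<partial>mixture \<Delta> \<mu> \<rho>)"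
      using main[OF f] mix f by (simp add: integral_distr[OF YT fm] is_mixture_def)
  qed
qed

end
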